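(* Let the stopping model $\mathcal{N}=\{N_\eta: h_{N_\eta},\ \eta\in[\eta_0,\infty)\}$ be uniparametric, closed under pgf composition (parametrized by $\eta=-\log\Pr(N_\eta=1)$) and extreme auto-reversible. Then the four statistically stable combined model extensions coincide, $$max^{-1}_{\mathcal{N}}(max_{\mathcal{N}}(\cdot))=max_{\mathcal{N}}(max^{-1}_{\mathcal{N}}(\cdot))=min^{-1}_{\mathcal{N}}(min_{\mathcal{N}}(\cdot))=min_{\mathcal{N}}(min^{-1}_{\mathcal{N}}(\cdot)),$$ and they coincide with $min_{\mathcal{N}}(max_{\mathcal{N}}(\cdot))$ and with $max_{\mathcal{N}}(min_{\mathcal{N}}(\cdot))$. If on top of that $N_I\in\mathcal{N}$ (i.e. $\eta_0=0$), where $\Pr(N_I=1)=1$, then this statistically stable model extension also coincides with $max_{\mathcal{N}}(\cdot)\cup min_{\mathcal{N}}(\cdot)$.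
   Context: A statistical model $\mathcal{X}=\{X_\theta:\theta\in\Theta\}$ is a family of real random variables, identified with the set of their cumulative distribution functions $F_{X_\theta}$. Models are compared as sets of distributions, and two model transformations coincide if they agree on every statistical model. A stopping model $\mathcal{N}=\{N_\delta:\delta\in\mathcal{D}\}$ is a family of positive integer valued random variables ($\Pr(N_\delta=0)=0$), with probability generating functions (pgfs) $h_{N_\delta}(t)=\sum_{i\ge1}p_i(\delta)t^i$, $p_i(\delta)=\Pr(N_\delta=i)$, $t\in[0,1]$. Each $h_{N_\delta}$ is an increasing bijection of $[0,1]$ with inverse $h_{N_\delta}^{-1}$, and $\overline{h}_{N_\delta}(t)=1-h_{N_\delta}(1-t)$ is its conjugate, with inverse $\overline{h}_{N_\delta}^{-1}$. $\mathcal{N}$ is closed under pgf composition if for all $N_{\delta_1},N_{\delta_2}\in\mathcal{N}$ the random variable with pgf $h_{N_{\delta_1}}\circ h_{N_{\delta_2}}$ belongs to $\mathcal{N}$. $\mathcal{N}$ is "uniparametric and closed under pgf composition" if it is closed under pgf composition and has a parametrization $\delta\in\mathcal{D}$ in which every $p_i(\delta)$ is continuously differentiable in $\delta$ and $\mathcal{D}$ is a connected subset of $\mathbb{R}$ with non-empty interior. By the paper's standing convention such models are parametrized by $\eta=-\log\Pr(N_\eta=1)$ (with $\Pr(N_\eta=1)>0$), with parameter space $[\eta_0,\infty)$, $\eta_0\ge0$, each $\eta$ corresponding to exactly one distribution in $\mathcal{N}$. A positive integer valued random variable $N$ is extreme auto-reversible if $\overline{h}_N^{-1}=h_N$ (equivalently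 $h_N^{-1}=\overline{h}_N$); the stopping model $\mathcal{N}$ is extreme auto-reversible if all $N\in\mathcal{N}$ are. Transformations: $max_{\mathcal{N}}(\mathcal{X})$, $max^{-1}_{\mathcal{N}}(\mathcal{X})$, $min_{\mathcal{N}}(\mathcal{X})$, $min^{-1}_{\mathcal{N}}(\mathcal{X})$ are the models consisting of the random variables with cdfs, respectively, $h_{N_\eta}(F_{X_\theta})$, $h^{-1}_{N_\eta}(F_{X_\theta})$, $\overline{h}_{N_\eta}(F_{X_\theta})$, $\overline{h}^{-1}_{N_\eta}(F_{X_\theta})$, for $\theta\in\Theta$ and $\eta\in[\eta_0,\infty)$. Combined transformations are the successive application of two of these, with independently varying parameters; e.g. $max_{\mathcal{N}}(max^{-1}_{\mathcal{N}}(\mathcal{X}))$ has cdfs $h_{N_{\eta_2}}\circ h^{-1}_{N_{\eta_1}}(F_{X_\theta})$ and $min_{\mathcal{N}}(max_{\mathcal{N}}(\mathcal{X}))$ has cdfs $\overline{h}_{N_{\eta_2}}\circ h_{N_{\eta_1}}(F_{X_\theta})$, for $\theta\in\Theta$, $\eta_1,\eta_2\in[\eta_0,\infty)$. The transformation $max_{\mathcal{N}}(\cdot)\cup min_{\mathcal{N}}(\cdot)$ maps $\mathcal{X}$ to $max_{\mathcal{N}}(\mathcal{X})\cup min_{\mathcal{N}}(\mathcal{X})$. A model transformation $\mathcal{T}$ is a model extension if $\mathcal{X}\subseteq\mathcal{T}(\mathcal{X})$ for all $\mathcal{X}$, and is statistically stable if $\mathcal{T}(\mathcal{T}(\mathcal{X}))=\mathcal{T}(\mathcal{X})$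 for every statistical model $\mathcal{X}$. *)

theory Defs
  imports "HOL-Probability.Probability"
begin

text \<open>A random variable enters only through its distribution: a real random variable through its
  cumulative distribution function, a positive integer valued one through its law on the naturals.\<close>

definition statistical_model :: "(real \<Rightarrow> real) set \<Rightarrow> bool" where
  "statistical_model X \<longleftrightarrow> X \<subseteq> {cdf M | M. real_distribution M}"

definition stopping_model :: "nat pmf set \<Rightarrow> bool" where
  "stopping_model \<N> \<longleftrightarrow> (\<forall>N\<in>\<N>. pmf N 0 = 0)"

text \<open>The functions below are only meaningful on the unit interval, the domain of a pgf.
  For a member of a stopping model the term with index 0 of the series vanishes.\<close>

definition pgf :: "nat pmf \<Rightarrow> real \<Rightarrow> real" where
  "pgf N t = (\<Sum>i. pmf N i * t ^ i)"

definition pgf_inv :: "nat pmf \<Rightarrow> real \<Rightarrow> real" where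
  "pgf_inv N = the_inv_into {0..1} (pgf N)"

definition conj_pgf :: "nat pmf \<Rightarrow> real \<Rightarrow> real" where
  "conj_pgf N t = 1 - pgf N (1 - t)"

definition conj_pgf_inv :: "nat pmf \<Rightarrow> real \<Rightarrow> real" where
  "conj_pgf_inv N = the_inv_into {0..1} (conj_pgf N)"

definition closed_under_pgf_composition :: "nat pmf set \<Rightarrow> bool" where
  "closed_under_pgf_composition \<N> \<longleftrightarrow>
     (\<forall>N1\<in>\<N>. \<forall>N2\<in>\<N>. \<exists>N\<in>\<N>. \<forall>t\<in>{0..1}. pgf N t = pgf N1 (pgf N2 t))"

text \<open>Derivatives are taken within \<open>S\<close>, hence one-sided at end points of \<open>S\<close> that belong to \<open>S\<close>.\<close>

definition continuously_differentiable_on :: "(real \<Rightarrow> real) \<Rightarrow> real set \<Rightarrow> bool" where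
  "continuously_differentiable_on f S \<longleftrightarrow>
     (\<exists>f'. (\<forall>x\<in>S. (f has_real_derivative f' x) (at x within S)) \<and> continuous_on S f')"

definition uniparametric :: "nat pmf set \<Rightarrow> bool" where
  "uniparametric \<N> \<longleftrightarrow>
     (\<exists>(D :: real set) P. connected D \<and> interior D \<noteq> {} \<and> \<N> = P ` D \<and>
        (\<forall>i\<ge>1. continuously_differentiable_on (\<lambda>\<delta>. pmf (P \<delta>) i) D))"

text \<open>The canonical parametrization of \<open>\<N>\<close> by \<open>\<eta> = - log Pr(N = 1)\<close>. The last conjunct makes \<open>N\<close>
  injective, and each \<open>\<eta>\<close> is attained by exactly one law in \<open>\<N>\<close>.\<close>

definition eta_parametrization :: "nat pmf set \<Rightarrow> real \<Rightarrow> (real \<Rightarrow> nat pmf) \<Rightarrow> bool" where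
  "eta_parametrization \<N> \<eta>0 N \<longleftrightarrow>
     0 \<le> \<eta>0 \<and> \<N> = N ` {\<eta>0..} \<and>
     (\<forall>\<eta>\<ge>\<eta>0. 0 < pmf (N \<eta>) 1 \<and> \<eta> = - ln (pmf (N \<eta>) 1))"

definition extreme_auto_reversible :: "nat pmf \<Rightarrow> bool" where
  "extreme_auto_reversible N \<longleftrightarrow> (\<forall>t\<in>{0..1}. conj_pgf_inv N t = pgf N t)"

definition extreme_auto_reversible_model :: "nat pmf set \<Rightarrow> bool" where
  "extreme_auto_reversible_model \<N> \<longleftrightarrow> (\<forall>N\<in>\<N>. extreme_auto_reversible N)"

type_synonym transformation = "(real \<Rightarrow> real) set \<Rightarrow> (real \<Rightarrow> real) set"

definition max_tr :: "nat pmf set \<Rightarrow> transformation" where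
  "max_tr \<N> X = {pgf N \<circ> F | N F. N \<in> \<N> \<and> F \<in> X}"

definition max_inv_tr :: "nat pmf set \<Rightarrow> transformation" where
  "max_inv_tr \<N> X = {pgf_inv N \<circ> F | N F. N \<in> \<N> \<and> F \<in> X}"

definition min_tr :: "nat pmf set \<Rightarrow> transformation" where
  "min_tr \<N> X = {conj_pgf N \<circ> F | N F. N \<in> \<N> \<and> F \<in> X}"

definition min_inv_tr :: "nat pmf set \<Rightarrow> transformation" where
  "min_inv_tr \<N> X = {conj_pgf_inv N \<circ> F | N F. N \<in> \<N> \<and> F \<in> X}"

definition coincide :: "transformation \<Rightarrow> transformation \<Rightarrow> bool" where
  "coincide S T \<longleftrightarrow> (\<forall>X. statistical_model X \<longrightarrow> S X = T X)"

definition model_transformation :: "transformation \<Rightarrow> bool" where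
  "model_transformation T \<longleftrightarrow> (\<forall>X. statistical_model X \<longrightarrow> statistical_model (T X))"

definition model_extension :: "transformation \<Rightarrow> bool" where
  "model_extension T \<longleftrightarrow>
     model_transformation T \<and> (\<forall>X. statistical_model X \<longrightarrow> X \<subseteq> T X)"

definition statistically_stable :: "transformation \<Rightarrow> bool" where
  "statistically_stable T \<longleftrightarrow> (\<forall>X. statistical_model X \<longrightarrow> T (T X) = T X)"

end

theory Submission imports Defs begin

text \<open>
  A pgf \<open>h\<close> of a positive integer valued law is an increasing bijection of the unit interval, and
  extreme auto-reversibility says that its inverse is its conjugate. Cdfs take values in the unit
  interval, so on models the inverse transformations disappear: \<open>max_inv_tr\<close> is \<open>min_tr\<close> and
  \<open>min_inv_tr\<close> is \<open>max_tr\<close> (\<open>max_inv_tr_eq_min_tr\<close>, \<open>min_inv_tr_eq_max_tr\<close>). All six combined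
  transformations are therefore one of \<open>min_tr \<circ> max_tr\<close> and \<open>max_tr \<circ> min_tr\<close>.

  These two agree because the pgfs of the model commute. The chain rule at the fixed point 0
  (\<open>pmf_1_pgf_composition\<close>) shows that \<open>h\<^sub>a \<circ> h\<^sub>b\<close>, which is the pgf of a member of the model, has the
  parameter \<open>a + b\<close>; as a parameter determines the law, \<open>h\<^sub>a \<circ> h\<^sub>b = h\<^bsub>a + b\<^esub>\<close>
  (\<open>eta_parametrization_pgf_compose\<close>). The model is thus an additive semigroup of bijections, and
  \<open>h\<^sub>a\<close> also commutes with the inverse of \<open>h\<^sub>b\<close>.

  The transformation \<open>T = min_tr \<circ> max_tr\<close> extends every model since \<open>h\<^sub>a\<close> is undone by its inverse.
  It is stable since, by commutation, \<open>T \<circ> T\<close> is \<open>min_tr\<close> twice after \<open>max_tr\<close> twice, and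
  repeating \<open>max_tr\<close> or \<open>min_tr\<close> yields nothing new by closedness. If the identity belongs to the
  model, the parameters fill the half-line from 0, so that the inverse of \<open>h\<^sub>b\<close> composed with \<open>h\<^sub>a\<close>
  is \<open>h\<^bsub>a - b\<^esub>\<close> or the inverse of \<open>h\<^bsub>b - a\<^esub>\<close>: each member of \<open>T X\<close> already is a maximum or
  a minimum (\<open>min_tr_max_tr_eq_Un\<close>).
\<close>

section \<open>Probability generating functions on the unit interval\<close>

lemma pmf_nat_sums_1: "(\<lambda>i. pmf N i) sums 1" for N :: "nat pmf"
proof -
  have "(\<lambda>i. measure (measure_pmf N) {i}) sums measure (measure_pmf N) (\<Union>i. {i})"
    by (rule measure_pmf.finite_measure_UNION) (auto simp: disjoint_family_on_def)
  thus ?thesis by (simp add: measure_pmf_single)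
qed

lemma pgf_summable:
  assumes "t \<in> {0..1}"
  shows "summable (\<lambda>i. pmf N i * t ^ i)"
proof (rule summable_comparison_test[OF _ sums_summable[OF pmf_nat_sums_1[of N]]])
  show "\<exists>n. \<forall>i\<ge>n. norm (pmf N i * t ^ i) \<le> pmf N i"
    using assms by (auto simp: abs_mult power_le_one mult_left_le)
qed

lemma pgf_at_0: "pgf N 0 = pmf N 0"
  unfolding pgf_def using powser_sums_zero[of "pmf N"] by (rule sums_unique[symmetric])

lemma pgf_at_1: "pgf N 1 = 1"
  unfolding pgf_def using sums_unique[OF pmf_nat_sums_1[of N]] by simp

lemma pgf_strict_mono:
  assumes "pmf N 0 = 0" "0 \<le> s" "s < t" "t \<le> 1"
  shows "pgf N s < pgf N t"
proof -
  \<comment> \<open>All terms of the series are weakly increasing; one non-constant term in the support suffices.\<close>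
  obtain i where i: "i \<in> set_pmf N" using set_pmf_not_empty[of N] by blast
  hence "i \<noteq> 0" using assms(1) by (metis set_pmf_iff)
  hence "s ^ i < t ^ i" using assms by (intro power_strict_mono) auto
  moreover have "0 < pmf N i" using i by (simp add: pmf_positive)
  ultimately have "pmf N i * s ^ i < pmf N i * t ^ i" by simp
  hence pos: "0 < pmf N i * t ^ i - pmf N i * s ^ i" by simp
  have nonneg: "0 \<le> pmf N j * t ^ j - pmf N j * s ^ j" for j
    using mult_left_mono[OF power_mono[of s t j] pmf_nonneg[of N j]] assms by simp
  have "summable (\<lambda>j. pmf N j * s ^ j)" "summable (\<lambda>j. pmf N j * t ^ j)"
    using assms by (auto intro!: pgf_summable)
  hence "0 < (\<Sum>j. pmf N j * t ^ j - pmf N j * s ^ j)"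
    by (intro suminf_pos2[where i = i, OF _ nonneg] pos summable_diff)
  thus ?thesis
    unfolding pgf_def using assms by (simp add: suminf_diff[symmetric] pgf_summable)
qed

text \<open>The pmf is a summable majorant of the series on the whole closed interval, hence convergence
  is uniform and continuity reaches the end point 1, which may lie on the boundary of the disc of
  convergence.\<close>

lemma pgf_continuous_on: "continuous_on {0..1} (pgf N)"
proof -
  have "uniform_limit {0..1} (\<lambda>n t. \<Sum>i<n. pmf N i * t ^ i) (\<lambda>t. \<Sum>i. pmf N i * t ^ i) sequentially"
    by (rule Weierstrass_m_test[OF _ sums_summable[OF pmf_nat_sums_1[of N]]])
       (auto simp: abs_mult power_le_one mult_left_le)
  hence "continuous_on {0..1} (\<lambda>t. \<Sum>i. pmf N i * t ^ i)"
    by (rule uniform_limit_theorem[rotated])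
       (auto intro!: always_eventually continuous_intros)
  thus ?thesis by (simp add: pgf_def[abs_def])
qed

lemma strict_mono_continuous_bij_betw_unit_interval:
  fixes f :: "real \<Rightarrow> real"
  assumes "\<And>s t. 0 \<le> s \<Longrightarrow> s < t \<Longrightarrow> t \<le> 1 \<Longrightarrow> f s < f t"
    and "continuous_on {0..1} f" "f 0 = 0" "f 1 = 1"
  shows "bij_betw f {0..1} {0..1}"
proof (rule bij_betw_imageI)
  show "inj_on f {0..1}"
    by (rule linorder_inj_onI) (use assms(1) in \<open>force+\<close>)
  show "f ` {0..1} = {0..1}"
  proof
    have "f 0 \<le> f t" "f t \<le> f 1" if "t \<in> {0..1}" for t
      using assms(1)[of 0 t] assms(1)[of t 1] that by (cases "t = 0"; cases "t = 1"; force)+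
    thus "f ` {0..1} \<subseteq> {0..1}" using assms(3,4) by auto
    show "{0..1} \<subseteq> f ` {0..1}"
    proof
      fix y :: real assume "y \<in> {0..1}"
      thus "y \<in> f ` {0..1}" using IVT'[of f 0 y 1] assms(2-4) by force
    qed
  qed
qed

lemma pgf_bij_betw:
  assumes "pmf N 0 = 0"
  shows "bij_betw (pgf N) {0..1} {0..1}"
  by (rule strict_mono_continuous_bij_betw_unit_interval)
     (use assms in \<open>auto simp: pgf_at_0 pgf_at_1 intro: pgf_strict_mono pgf_continuous_on\<close>)

lemma conj_pgf_strict_mono:
  assumes "pmf N 0 = 0" "0 \<le> s" "s < t" "t \<le> 1"
  shows "conj_pgf N s < conj_pgf N t"
  using assms by (simp add: conj_pgf_def pgf_strict_mono)

lemma conj_pgf_continuous_on: "continuous_on {0..1} (conj_pgf N)"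
  unfolding conj_pgf_def[abs_def]
  by (intro continuous_intros continuous_on_compose2[OF pgf_continuous_on]) auto

lemma conj_pgf_bij_betw:
  assumes "pmf N 0 = 0"
  shows "bij_betw (conj_pgf N) {0..1} {0..1}"
  by (rule strict_mono_continuous_bij_betw_unit_interval)
     (use assms in \<open>auto simp: conj_pgf_def[of _ 0] conj_pgf_def[of _ 1] pgf_at_0 pgf_at_1
        intro: conj_pgf_strict_mono conj_pgf_continuous_on\<close>)

lemma pgf_mem_unit_interval: "pmf N 0 = 0 \<Longrightarrow> t \<in> {0..1} \<Longrightarrow> pgf N t \<in> {0..1}"
  by (rule bij_betw_apply[OF pgf_bij_betw])

lemma conj_pgf_mem_unit_interval: "pmf N 0 = 0 \<Longrightarrow> t \<in> {0..1} \<Longrightarrow> conj_pgf N t \<in> {0..1}"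
  by (rule bij_betw_apply[OF conj_pgf_bij_betw])

lemma pgf_has_derivative_at_0: "(pgf N has_real_derivative pmf N 1) (at 0)"
proof -
  have "DERIV (\<lambda>t. \<Sum>i. pmf N i * t ^ i) 0 :> (\<Sum>i. diffs (pmf N) i * 0 ^ i)"
    by (rule termdiffs_strong[where K = 1]) (use pgf_summable[of 1 N] in auto)
  moreover have "(\<Sum>i. diffs (pmf N) i * 0 ^ i) = pmf N 1"
    using sums_unique[OF powser_sums_zero[of "diffs (pmf N)"]] by (simp add: diffs_def)
  ultimately show ?thesis by (simp add: pgf_def[abs_def])
qed

text \<open>This is the chain rule at the common fixed point 0. It turns composition of pgfs into addition
  of the parameters \<open>- ln (pmf N 1)\<close>. The derivatives are taken within the unit interval because
  the composition identity is available only there.\<close>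

lemma pmf_1_pgf_composition:
  assumes "pmf N2 0 = 0" and eq: "\<And>t. t \<in> {0..1} \<Longrightarrow> pgf N t = pgf N1 (pgf N2 t)"
  shows "pmf N 1 = pmf N1 1 * pmf N2 1"
proof (rule has_field_derivative_unique)
  have "(pgf N1 has_real_derivative pmf N1 1) (at (pgf N2 0))"
    using assms(1) by (simp add: pgf_at_0 pgf_has_derivative_at_0[unfolded One_nat_def])
  hence "((\<lambda>t. pgf N1 (pgf N2 t)) has_real_derivative pmf N1 1 * pmf N2 1) (at 0 within {0..1})"
    by (rule DERIV_chain2)
       (rule has_field_derivative_at_within[OF pgf_has_derivative_at_0])
  thus "(pgf N has_real_derivative pmf N1 1 * pmf N2 1) (at 0 within {0..1})"
    by (rule has_field_derivative_transform_within[where d = 1]) (use eq in auto)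
  show "(pgf N has_real_derivative pmf N 1) (at 0 within {0..1})"
    by (rule has_field_derivative_at_within[OF pgf_has_derivative_at_0])
  show "at (0::real) within {0..1} \<noteq> bot"
    by (simp add: at_within_Icc_at_right)
qed

lemma conj_pgf_composition:
  assumes "t \<in> {0..1}" and "\<And>u. u \<in> {0..1} \<Longrightarrow> pgf N u = pgf N1 (pgf N2 u)"
  shows "conj_pgf N t = conj_pgf N1 (conj_pgf N2 t)"
  using assms(1) assms(2)[of "1 - t"] by (simp add: conj_pgf_def)


section \<open>Increasing transformations of cumulative distribution functions\<close>

lemma cdf_mem_unit_interval:
  assumes "statistical_model X" "F \<in> X"
  shows "F x \<in> {0..1}"
proof -
  obtain M where "F = cdf M" "real_distribution M"
    using assms by (auto simp: statistical_model_def)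
  thus ?thesis
    by (simp add: cdf_def real_distribution.axioms(1) prob_space.prob_le_1)
qed

text \<open>A function is the cdf of a real distribution iff it is nondecreasing, right-continuous and
  tends to 0 and 1 at the two ends. Composition with an increasing continuous map of the unit
  interval that fixes its end points preserves these properties.\<close>

lemma comp_cdf_is_cdf:
  fixes f :: "real \<Rightarrow> real"
  assumes "real_distribution M"
    and mono: "\<And>s t. 0 \<le> s \<Longrightarrow> s < t \<Longrightarrow> t \<le> 1 \<Longrightarrow> f s < f t"
    and cont: "continuous_on {0..1} f" and f0: "f 0 = 0" and f1: "f 1 = 1"
  shows "\<exists>M'. real_distribution M' \<and> f \<circ> cdf M = cdf M'"
proof -
  interpret real_distribution M by fact
  have unit: "cdf M x \<in> {0..1}" for x
    by (simp add: cdf_nonneg cdf_bounded_prob)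
  have lim: "((\<lambda>x. f (cdf M x)) \<longlongrightarrow> f l) G" if "(cdf M \<longlongrightarrow> l) G" "l \<in> {0..1}" for l G
    by (rule continuous_on_tendsto_compose[OF cont that]) (use unit in auto)
  let ?F = "f \<circ> cdf M"
  have *: "?F x \<le> ?F y" if "x \<le> y" for x y
    using mono[of "cdf M x" "cdf M y"] cdf_nondecreasing[OF that] unit[of x] unit[of y]
    by (cases "cdf M x = cdf M y") auto
  moreover have "continuous (at_right a) ?F" for a
    using lim[OF cdf_is_right_cont[of a, unfolded continuous_within] unit]
    by (simp add: continuous_within comp_def)
  moreover have "(?F \<longlongrightarrow> 0) at_bot"
    using lim[OF cdf_lim_at_bot] f0 by (simp add: comp_def)
  moreover have "(?F \<longlongrightarrow> 1) at_top"
    using lim[OF cdf_lim_at_top_prob] f1 by (simp add: comp_def)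
  ultimately have "real_distribution (interval_measure ?F)" "cdf (interval_measure ?F) = ?F"
    by (simp_all only: real_distribution_interval_measure cdf_interval_measure)
  thus ?thesis by metis
qed

lemma statistical_model_max_tr:
  assumes "stopping_model \<N>" "statistical_model X"
  shows "statistical_model (max_tr \<N> X)"
  unfolding statistical_model_def
proof
  fix G assume "G \<in> max_tr \<N> X"
  then obtain N M where N: "N \<in> \<N>" and M: "real_distribution M" and G: "G = pgf N \<circ> cdf M"
    using assms(2) by (auto simp: max_tr_def statistical_model_def)
  have "pmf N 0 = 0" using N assms(1) by (simp add: stopping_model_def)
  hence "\<exists>M'. real_distribution M' \<and> G = cdf M'"
    unfolding G
    by (intro comp_cdf_is_cdf[OF M])
       (auto simp: pgf_at_0 pgf_at_1 intro: pgf_strict_mono pgf_continuous_on)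
  thus "G \<in> {cdf M | M. real_distribution M}" by blast
qed

lemma statistical_model_min_tr:
  assumes "stopping_model \<N>" "statistical_model X"
  shows "statistical_model (min_tr \<N> X)"
  unfolding statistical_model_def
proof
  fix G assume "G \<in> min_tr \<N> X"
  then obtain N M where N: "N \<in> \<N>" and M: "real_distribution M" and G: "G = conj_pgf N \<circ> cdf M"
    using assms(2) by (auto simp: min_tr_def statistical_model_def)
  have "pmf N 0 = 0" using N assms(1) by (simp add: stopping_model_def)
  hence "\<exists>M'. real_distribution M' \<and> G = cdf M'"
    unfolding G
    by (intro comp_cdf_is_cdf[OF M])
       (auto simp: conj_pgf_def[of _ 0] conj_pgf_def[of _ 1] pgf_at_0 pgf_at_1
          intro: conj_pgf_strict_mono conj_pgf_continuous_on)
  thus "G \<in> {cdf M | M. real_distribution M}" by blast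
qed

text \<open>Half of the stability of the combined extension. Only an inclusion is available: with least
  parameter \<open>\<eta>0 > 0\<close>, two successive maxima have parameter at least \<open>2 * \<eta>0\<close>.\<close>

lemma max_tr_max_tr_subset:
  assumes "closed_under_pgf_composition \<N>" "statistical_model X"
  shows "max_tr \<N> (max_tr \<N> X) \<subseteq> max_tr \<N> X"
proof
  fix G assume "G \<in> max_tr \<N> (max_tr \<N> X)"
  then obtain N1 N2 F where N12: "N1 \<in> \<N>" "N2 \<in> \<N>" and F: "F \<in> X" and
    G: "G = pgf N1 \<circ> (pgf N2 \<circ> F)"
    by (auto simp: max_tr_def)
  obtain N where N: "N \<in> \<N>" "\<And>t. t \<in> {0..1} \<Longrightarrow> pgf N t = pgf N1 (pgf N2 t)"
    using assms(1) N12 unfolding closed_under_pgf_composition_def by meson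
  hence "G = pgf N \<circ> F"
    using cdf_mem_unit_interval[OF assms(2) F] by (simp add: G fun_eq_iff)
  thus "G \<in> max_tr \<N> X" using N(1) F by (auto simp: max_tr_def)
qed

lemma min_tr_min_tr_subset:
  assumes "closed_under_pgf_composition \<N>" "statistical_model X"
  shows "min_tr \<N> (min_tr \<N> X) \<subseteq> min_tr \<N> X"
proof
  fix G assume "G \<in> min_tr \<N> (min_tr \<N> X)"
  then obtain N1 N2 F where N12: "N1 \<in> \<N>" "N2 \<in> \<N>" and F: "F \<in> X" and
    G: "G = conj_pgf N1 \<circ> (conj_pgf N2 \<circ> F)"
    by (auto simp: min_tr_def)
  obtain N where N: "N \<in> \<N>" "\<And>t. t \<in> {0..1} \<Longrightarrow> pgf N t = pgf N1 (pgf N2 t)"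
    using assms(1) N12 unfolding closed_under_pgf_composition_def by meson
  hence "conj_pgf N t = conj_pgf N1 (conj_pgf N2 t)" if "t \<in> {0..1}" for t
    using that by (blast intro: conj_pgf_composition)
  hence "G = conj_pgf N \<circ> F"
    using cdf_mem_unit_interval[OF assms(2) F] by (simp add: G fun_eq_iff)
  thus "G \<in> min_tr \<N> X" using N(1) F by (auto simp: min_tr_def)
qed

lemma min_tr_mono: "X \<subseteq> Y \<Longrightarrow> min_tr \<N> X \<subseteq> min_tr \<N> Y"
  by (auto simp: min_tr_def)


section \<open>Extreme auto-reversibility\<close>

text \<open>Extreme auto-reversibility equates the pgf with the inverse of its conjugate. Since both maps are
  bijections of the unit interval, the pgf and its conjugate are inverse to each other on either
  side.\<close>

lemma conj_pgf_pgf: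
  assumes "pmf N 0 = 0" "extreme_auto_reversible N" "t \<in> {0..1}"
  shows "conj_pgf N (pgf N t) = t"
  using f_the_inv_into_f_bij_betw[OF conj_pgf_bij_betw[OF assms(1)]] assms(2,3)
  by (metis conj_pgf_inv_def extreme_auto_reversible_def)

lemma pgf_conj_pgf:
  assumes "pmf N 0 = 0" "extreme_auto_reversible N" "t \<in> {0..1}"
  shows "pgf N (conj_pgf N t) = t"
proof -
  have "conj_pgf_inv N (conj_pgf N t) = t"
    unfolding conj_pgf_inv_def
    using the_inv_into_f_f[OF bij_betw_imp_inj_on[OF conj_pgf_bij_betw[OF assms(1)]] assms(3)] .
  thus ?thesis
    using assms(2) conj_pgf_mem_unit_interval[OF assms(1,3)] by (simp add: extreme_auto_reversible_def)
qed

lemma pgf_inv_eq_conj_pgf: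
  assumes "pmf N 0 = 0" "extreme_auto_reversible N" "t \<in> {0..1}"
  shows "pgf_inv N t = conj_pgf N t"
  unfolding pgf_inv_def
  by (rule the_inv_into_f_eq[OF bij_betw_imp_inj_on[OF pgf_bij_betw[OF assms(1)]]])
     (use assms in \<open>simp_all add: pgf_conj_pgf conj_pgf_mem_unit_interval del: atLeastAtMost_iff\<close>)

lemma max_inv_tr_eq_min_tr:
  assumes "stopping_model \<N>" "extreme_auto_reversible_model \<N>" "statistical_model X"
  shows "max_inv_tr \<N> X = min_tr \<N> X"
proof -
  have "pgf_inv N \<circ> F = conj_pgf N \<circ> F" if "N \<in> \<N>" "F \<in> X" for N F
    using that assms cdf_mem_unit_interval[OF assms(3), of F] unfolding fun_eq_iff comp_def
    by (metis pgf_inv_eq_conj_pgf stopping_model_def extreme_auto_reversible_model_def)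
  thus ?thesis unfolding max_inv_tr_def min_tr_def by (metis (no_types, lifting))
qed

lemma min_inv_tr_eq_max_tr:
  assumes "extreme_auto_reversible_model \<N>" "statistical_model X"
  shows "min_inv_tr \<N> X = max_tr \<N> X"
proof -
  have "conj_pgf_inv N \<circ> F = pgf N \<circ> F" if "N \<in> \<N>" "F \<in> X" for N F
    using that assms cdf_mem_unit_interval[OF assms(2), of F] unfolding fun_eq_iff comp_def
    by (metis extreme_auto_reversible_def extreme_auto_reversible_model_def)
  thus ?thesis unfolding min_inv_tr_def max_tr_def by (metis (no_types, lifting))
qed

text \<open>Using the same law for both transformations returns the original cdf.\<close>

lemma subset_min_tr_max_tr:
  assumes "stopping_model \<N>" "extreme_auto_reversible_model \<N>" "\<N> \<noteq> {}" "statistical_model X"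
  shows "X \<subseteq> min_tr \<N> (max_tr \<N> X)"
proof
  fix F assume F: "F \<in> X"
  obtain N where N: "N \<in> \<N>" using assms(3) by blast
  hence eq: "F = conj_pgf N \<circ> (pgf N \<circ> F)"
    using cdf_mem_unit_interval[OF assms(4) F] assms(1,2)
    by (simp add: fun_eq_iff conj_pgf_pgf stopping_model_def extreme_auto_reversible_model_def)
  have "pgf N \<circ> F \<in> max_tr \<N> X" using N F unfolding max_tr_def by blast
  thus "F \<in> min_tr \<N> (max_tr \<N> X)" using N eq unfolding min_tr_def by blast
qed

text \<open>By closedness the composition is the pgf of some member of the model. Its parameter is \<open>a + b\<close> by
  the chain rule at 0, and a member is determined by its parameter.\<close>

lemma eta_parametrization_pgf_compose:
  assumes "stopping_model \<N>" "closed_under_pgf_composition \<N>" "eta_parametrization \<N> \<eta>0 N"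
    and ab: "\<eta>0 \<le> a" "\<eta>0 \<le> b" and t: "t \<in> {0..1}"
  shows "pgf (N a) (pgf (N b) t) = pgf (N (a + b)) t"
proof -
  have eta: "\<N> = N ` {\<eta>0..}" "\<And>c. \<eta>0 \<le> c \<Longrightarrow> 0 < pmf (N c) 1" "\<And>c. \<eta>0 \<le> c \<Longrightarrow> c = - ln (pmf (N c) 1)"
    using assms(3) unfolding eta_parametrization_def by blast+
  have mem: "N a \<in> \<N>" "N b \<in> \<N>" using eta(1) ab by auto
  obtain M where M: "M \<in> \<N>" "\<And>u. u \<in> {0..1} \<Longrightarrow> pgf M u = pgf (N a) (pgf (N b) u)"
    using assms(2) mem unfolding closed_under_pgf_composition_def by meson
  obtain c where c: "\<eta>0 \<le> c" "M = N c" using M(1) eta(1) by auto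
  have "pmf (N b) 0 = 0" using mem assms(1) by (simp add: stopping_model_def)
  hence "pmf M 1 = pmf (N a) 1 * pmf (N b) 1" using M(2) by (rule pmf_1_pgf_composition)
  hence "ln (pmf (N c) 1) = ln (pmf (N a) 1) + ln (pmf (N b) 1)"
    using eta(2)[OF ab(1)] eta(2)[OF ab(2)] c by (simp add: ln_mult)
  hence "c = a + b" using eta(3)[OF ab(1)] eta(3)[OF ab(2)] eta(3)[OF c(1)] by linarith
  thus ?thesis using M(2)[OF t] c by simp
qed

text \<open>A map that commutes with a bijection also commutes with its inverse.\<close>

lemma pgf_conj_pgf_commute:
  assumes "pmf N2 0 = 0" "extreme_auto_reversible N2" "pmf N1 0 = 0" "t \<in> {0..1}"
    and comm: "\<And>u. u \<in> {0..1} \<Longrightarrow> pgf N1 (pgf N2 u) = pgf N2 (pgf N1 u)"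
  shows "pgf N1 (conj_pgf N2 t) = conj_pgf N2 (pgf N1 t)"
proof -
  let ?u = "conj_pgf N2 t"
  have u: "?u \<in> {0..1}" using assms(1,4) by (rule conj_pgf_mem_unit_interval)
  have "conj_pgf N2 (pgf N1 t) = conj_pgf N2 (pgf N1 (pgf N2 ?u))"
    using assms by (simp add: pgf_conj_pgf)
  also have "\<dots> = conj_pgf N2 (pgf N2 (pgf N1 ?u))" using comm[OF u] by simp
  also have "\<dots> = pgf N1 ?u"
    using assms(1,2) pgf_mem_unit_interval[OF assms(3) u] by (rule conj_pgf_pgf)
  finally show ?thesis by simp
qed

lemma max_tr_min_tr_commute:
  assumes sm: "stopping_model \<N>" and cl: "closed_under_pgf_composition \<N>"
    and eta: "eta_parametrization \<N> \<eta>0 N" and ear: "extreme_auto_reversible_model \<N>"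
    and X: "statistical_model X"
  shows "max_tr \<N> (min_tr \<N> X) = min_tr \<N> (max_tr \<N> X)"
proof -
  have comm: "pgf N1 (pgf N2 t) = pgf N2 (pgf N1 t)"
    if N12: "N1 \<in> \<N>" "N2 \<in> \<N>" and t: "t \<in> {0..1}" for N1 N2 t
  proof -
    obtain a b where "\<eta>0 \<le> a" "N1 = N a" "\<eta>0 \<le> b" "N2 = N b"
      using N12 eta unfolding eta_parametrization_def by blast
    thus ?thesis
      using eta_parametrization_pgf_compose[OF sm cl eta _ _ t] by (simp add: add.commute)
  qed
  have *: "pgf N1 \<circ> (conj_pgf N2 \<circ> F) = conj_pgf N2 \<circ> (pgf N1 \<circ> F)"
    if "N1 \<in> \<N>" "N2 \<in> \<N>" "F \<in> X" for N1 N2 F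
  proof -
    have "pmf N1 0 = 0" "pmf N2 0 = 0" "extreme_auto_reversible N2"
      using that sm ear by (simp_all add: stopping_model_def extreme_auto_reversible_model_def)
    hence "pgf N1 (conj_pgf N2 (F x)) = conj_pgf N2 (pgf N1 (F x))" for x
      using comm[OF that(1,2)] cdf_mem_unit_interval[OF X that(3)] by (intro pgf_conj_pgf_commute)
    thus ?thesis by (simp add: fun_eq_iff)
  qed
  have "max_tr \<N> (min_tr \<N> X) = {pgf N1 \<circ> (conj_pgf N2 \<circ> F) | N1 N2 F. N1 \<in> \<N> \<and> N2 \<in> \<N> \<and> F \<in> X}"
    unfolding max_tr_def min_tr_def by blast
  also have "\<dots> = {conj_pgf N2 \<circ> (pgf N1 \<circ> F) | N1 N2 F. N1 \<in> \<N> \<and> N2 \<in> \<N> \<and> F \<in> X}"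
    by (intro Collect_cong ex_cong1) (auto simp only: *)
  also have "\<dots> = min_tr \<N> (max_tr \<N> X)"
    unfolding max_tr_def min_tr_def by blast
  finally show ?thesis .
qed

text \<open>The degenerate law has parameter 0, so \<open>\<eta>0 = 0\<close> and the difference of two parameters is, up to
  sign, again a parameter. A minimum with parameter \<open>b\<close> after a maximum with parameter \<open>a\<close> cancels
  to a maximum with parameter \<open>a - b\<close> or a minimum with parameter \<open>b - a\<close>. The converse inclusion
  takes the identity for one of the two steps.\<close>

lemma min_tr_max_tr_eq_Un:
  assumes sm: "stopping_model \<N>" and cl: "closed_under_pgf_composition \<N>"
    and eta: "eta_parametrization \<N> \<eta>0 N" and ear: "extreme_auto_reversible_model \<N>"
    and X: "statistical_model X" and I: "return_pmf 1 \<in> \<N>"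
  shows "min_tr \<N> (max_tr \<N> X) = max_tr \<N> X \<union> min_tr \<N> X"
proof
  note compose = eta_parametrization_pgf_compose[OF sm cl eta]
  have N: "\<N> = N ` {\<eta>0..}" "0 \<le> \<eta>0" and ln: "\<And>a. \<eta>0 \<le> a \<Longrightarrow> a = - ln (pmf (N a) 1)"
    using eta unfolding eta_parametrization_def by blast+
  obtain i where "\<eta>0 \<le> i" "return_pmf 1 = N i" using I N(1) by auto
  hence "i = 0" using ln[of i] by (metis indicator_simps(1) ln_one minus_zero pmf_return singletonI)
  hence \<eta>0: "\<eta>0 = 0" using \<open>\<eta>0 \<le> i\<close> N(2) by simp
  have zero: "pmf (N a) 0 = 0" and rev: "extreme_auto_reversible (N a)" and mem: "N a \<in> \<N>" if "0 \<le> a" for a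
    using that sm ear N(1) \<eta>0 by (auto simp: stopping_model_def extreme_auto_reversible_model_def)
  show "min_tr \<N> (max_tr \<N> X) \<subseteq> max_tr \<N> X \<union> min_tr \<N> X"
  proof
    fix G assume "G \<in> min_tr \<N> (max_tr \<N> X)"
    then obtain a b F where ab: "0 \<le> a" "0 \<le> b" and F: "F \<in> X"
      and G: "G = conj_pgf (N b) \<circ> (pgf (N a) \<circ> F)"
      unfolding min_tr_def max_tr_def N(1) \<eta>0 by auto
    have unit: "F x \<in> {0..1}" for x using X F by (rule cdf_mem_unit_interval)
    show "G \<in> max_tr \<N> X \<union> min_tr \<N> X"
    proof (cases "b \<le> a")
      case True
      have "G x = pgf (N (a - b)) (F x)" for x
      proof -
        have "G x = conj_pgf (N b) (pgf (N b) (pgf (N (a - b)) (F x)))"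
          using compose[OF _ _ unit, of b "a - b" x] True ab \<eta>0 by (simp add: G)
        also have "\<dots> = pgf (N (a - b)) (F x)"
          using True ab unit by (intro conj_pgf_pgf zero rev pgf_mem_unit_interval) auto
        finally show ?thesis .
      qed
      hence "G = pgf (N (a - b)) \<circ> F" by auto
      thus ?thesis using mem[of "a - b"] True F by (auto simp: max_tr_def)
    next
      case False
      have "G x = conj_pgf (N (b - a)) (F x)" for x
      proof -
        have "conj_pgf (N b) t = conj_pgf (N (b - a)) (conj_pgf (N a) t)" if "t \<in> {0..1}" for t
          by (rule conj_pgf_composition[OF that]) (use compose[of "b - a" a] False ab \<eta>0 in auto)
        hence "G x = conj_pgf (N (b - a)) (conj_pgf (N a) (pgf (N a) (F x)))"
          using pgf_mem_unit_interval[OF zero[OF ab(1)] unit] by (simp add: G)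
        thus ?thesis using conj_pgf_pgf[OF zero rev unit] ab by simp
      qed
      hence "G = conj_pgf (N (b - a)) \<circ> F" by auto
      thus ?thesis using mem[of "b - a"] False F by (auto simp: min_tr_def)
    qed
  qed
  have id: "pgf (return_pmf 1) t = t" for t
  proof -
    have "(\<lambda>i. pmf (return_pmf 1) i * t ^ i) = (\<lambda>i. if i = 1 then t ^ i else 0)"
      by (auto simp: fun_eq_iff indicator_def)
    thus ?thesis using sums_unique[OF sums_single[of 1 "\<lambda>i. t ^ i"]] by (simp add: pgf_def)
  qed
  have "F \<in> max_tr \<N> Y" "F \<in> min_tr \<N> Y" if "F \<in> Y" for F Y
  proof -
    have "F = pgf (return_pmf 1) \<circ> F" "F = conj_pgf (return_pmf 1) \<circ> F"
      unfolding fun_eq_iff comp_def conj_pgf_def id by simp_all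
    thus "F \<in> max_tr \<N> Y" "F \<in> min_tr \<N> Y"
      using I that unfolding max_tr_def min_tr_def by blast+
  qed
  hence "Y \<subseteq> max_tr \<N> Y" "Y \<subseteq> min_tr \<N> Y" for Y
    by blast+
  thus "max_tr \<N> X \<union> min_tr \<N> X \<subseteq> min_tr \<N> (max_tr \<N> X)"
    by (simp add: min_tr_mono)
qed


section \<open>The stable model extension\<close>

theorem proposition10:
  fixes \<N> :: "nat pmf set" and \<eta>0 :: real and N :: "real \<Rightarrow> nat pmf"
  assumes "stopping_model \<N>"
    and "uniparametric \<N>"
    and "closed_under_pgf_composition \<N>"
    and "eta_parametrization \<N> \<eta>0 N"
    and "extreme_auto_reversible_model \<N>"
  shows "(\<forall>T \<in> {max_inv_tr \<N> \<circ> max_tr \<N>, max_tr \<N> \<circ> max_inv_tr \<N>,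
                 min_inv_tr \<N> \<circ> min_tr \<N>, min_tr \<N> \<circ> min_inv_tr \<N>}.
            model_extension T \<and> statistically_stable T) \<and>
         coincide (max_inv_tr \<N> \<circ> max_tr \<N>) (max_tr \<N> \<circ> max_inv_tr \<N>) \<and>
         coincide (max_tr \<N> \<circ> max_inv_tr \<N>) (min_inv_tr \<N> \<circ> min_tr \<N>) \<and>
         coincide (min_inv_tr \<N> \<circ> min_tr \<N>) (min_tr \<N> \<circ> min_inv_tr \<N>) \<and>
         coincide (min_tr \<N> \<circ> min_inv_tr \<N>) (min_tr \<N> \<circ> max_tr \<N>) \<and>
         coincide (min_tr \<N> \<circ> min_inv_tr \<N>) (max_tr \<N> \<circ> min_tr \<N>) \<and>
         (return_pmf 1 \<in> \<N> \<longrightarrow>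
            coincide (min_tr \<N> \<circ> min_inv_tr \<N>) (\<lambda>X. max_tr \<N> X \<union> min_tr \<N> X))"
proof -
  note sm = assms(1) and cl = assms(3) and eta = assms(4) and ear = assms(5)
  define T where "T X = min_tr \<N> (max_tr \<N> X)" for X
  note maxmod = statistical_model_max_tr[OF sm] and minmod = statistical_model_min_tr[OF sm]
  note comm = max_tr_min_tr_commute[OF sm cl eta ear]
  have canonical:
    "(max_inv_tr \<N> \<circ> max_tr \<N>) X = T X" "(max_tr \<N> \<circ> max_inv_tr \<N>) X = T X"
    "(min_inv_tr \<N> \<circ> min_tr \<N>) X = T X" "(min_tr \<N> \<circ> min_inv_tr \<N>) X = T X"
    "(max_tr \<N> \<circ> min_tr \<N>) X = T X" if "statistical_model X" for X
    using that by (simp_all add: T_def max_inv_tr_eq_min_tr[OF sm ear] min_inv_tr_eq_max_tr[OF ear]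
        maxmod minmod comm)
  have Tmod: "statistical_model (T X)" if "statistical_model X" for X
    using that by (simp add: T_def maxmod minmod)
  have "\<N> \<noteq> {}" using eta unfolding eta_parametrization_def by blast
  hence Text: "X \<subseteq> T X" if "statistical_model X" for X
    unfolding T_def by (rule subset_min_tr_max_tr[OF sm ear _ that])
  \<comment> \<open>Commutation collects both maxima inside and both minima outside, where they collapse.\<close>
  have Tstable: "T (T X) = T X" if X: "statistical_model X" for X
  proof
    have "T (T X) = min_tr \<N> (min_tr \<N> (max_tr \<N> (max_tr \<N> X)))"
      unfolding T_def by (simp add: comm maxmod X)
    also have "\<dots> \<subseteq> min_tr \<N> (max_tr \<N> (max_tr \<N> X))"
      by (rule min_tr_min_tr_subset[OF cl maxmod[OF maxmod[OF X]]])
    also have "\<dots> \<subseteq> T X"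
      unfolding T_def by (rule min_tr_mono[OF max_tr_max_tr_subset[OF cl X]])
    finally show "T (T X) \<subseteq> T X" .
  qed (rule Text[OF Tmod[OF X]])
  have stable_extension: "model_extension S \<and> statistically_stable S"
    if "\<And>X. statistical_model X \<Longrightarrow> S X = T X" for S
    using that by (simp add: model_extension_def model_transformation_def statistically_stable_def
        Tmod Text Tstable)
  have coincideI: "coincide S S'"
    if "\<And>X. statistical_model X \<Longrightarrow> S X = T X" "\<And>X. statistical_model X \<Longrightarrow> S' X = T X" for S S'
    using that by (simp add: coincide_def)
  have min_max: "(min_tr \<N> \<circ> max_tr \<N>) X = T X" for X
    by (simp add: T_def)
  have union: "max_tr \<N> X \<union> min_tr \<N> X = T X" if "return_pmf 1 \<in> \<N>" "statistical_model X" for X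
    unfolding T_def using min_tr_max_tr_eq_Un[OF sm cl eta ear that(2,1)] ..
  show ?thesis
  proof (intro conjI impI ballI)
    fix S assume "S \<in> {max_inv_tr \<N> \<circ> max_tr \<N>, max_tr \<N> \<circ> max_inv_tr \<N>,
               min_inv_tr \<N> \<circ> min_tr \<N>, min_tr \<N> \<circ> min_inv_tr \<N>}"
    hence "S X = T X" if "statistical_model X" for X
      using canonical(1-4)[OF that] by (elim insertE emptyE) simp_all
    thus "model_extension S" "statistically_stable S"
      using stable_extension[of S] by simp_all
  qed (rule coincideI; simp only: canonical min_max union)+
qed

end
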